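(* There exist a finitely generated group $G$ and a class $\alpha\in H^2(G,\mathbb{Z})$ such that $\alpha$ is weakly bounded, but not bounded.
   Context: $C^*(G,\mathbb{Z})$ denotes the inhomogeneous bar complex of $G$ with trivial coefficients $\mathbb{Z}$, so an $n$-cochain is a map $\omega\colon G^n\to \mathbb{Z}$. A cochain $\omega\in C^n(G,\mathbb{Z})$ is bounded if $\omega(G^n)$ is bounded. It is weakly bounded if for every fixed $(g_2,\dots,g_n)\in G^{n-1}$ the set $\omega(G,g_2,\dots,g_n)=\{\omega(g,g_2,\dots,g_n): g\in G\}$ is bounded. A class in $H^n(G,\mathbb{Z})$ is bounded (resp. weakly bounded) if it is represented by a bounded (resp. weakly bounded) cocycle. *)

theory Defs
  imports "HOL-Algebra.Algebra"
begin

definition finitely_generated_group :: "('a, 'b) monoid_scheme \<Rightarrow> bool" where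
  "finitely_generated_group G \<longleftrightarrow>
     group G \<and> (\<exists>S. finite S \<and> S \<subseteq> carrier G \<and> generate G S = carrier G)"

text \<open>Elements of \<open>G\<^sup>n\<close> are lists \<open>[g\<^sub>1, \<dots>, g\<^sub>n]\<close> of length \<open>n\<close>. Cochains are
  extensional functions, so that maps \<open>G\<^sup>n \<rightarrow> \<int>\<close> are represented uniquely.\<close>

definition tuples :: "('a, 'b) monoid_scheme \<Rightarrow> nat \<Rightarrow> 'a list set" where
  "tuples G n = {gs. length gs = n \<and> set gs \<subseteq> carrier G}"

definition cochains :: "('a, 'b) monoid_scheme \<Rightarrow> nat \<Rightarrow> ('a list \<Rightarrow> int) monoid" where
  "cochains G n = product_group (tuples G n) (\<lambda>_. integer_group)"

text \<open>The differential is
  \<open>(d \<omega>)(g\<^sub>1, \<dots>, g\<^sub>n\<^sub>+\<^sub>1) = \<omega>(g\<^sub>2, \<dots>, g\<^sub>n\<^sub>+\<^sub>1)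
     + (\<Sum>i = 1..n. (-1)\<^sup>i \<omega>(g\<^sub>1, \<dots>, g\<^sub>i g\<^sub>i\<^sub>+\<^sub>1, \<dots>, g\<^sub>n\<^sub>+\<^sub>1)) + (-1)\<^sup>n\<^sup>+\<^sup>1 \<omega>(g\<^sub>1, \<dots>, g\<^sub>n)\<close>;
  list positions start at 0, so \<open>g\<^sub>i\<close> is \<open>gs ! (i - 1)\<close>.\<close>

definition merge_at :: "('a, 'b) monoid_scheme \<Rightarrow> nat \<Rightarrow> 'a list \<Rightarrow> 'a list" where
  "merge_at G i gs = take (i - 1) gs @ [gs ! (i - 1) \<otimes>\<^bsub>G\<^esub> gs ! i] @ drop (i + 1) gs"

definition bar_d :: "('a, 'b) monoid_scheme \<Rightarrow> nat \<Rightarrow> ('a list \<Rightarrow> int) \<Rightarrow> 'a list \<Rightarrow> int" where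
  "bar_d G n \<omega> = (\<lambda>gs \<in> tuples G (n + 1).
     \<omega> (tl gs) + (\<Sum>i = 1..n. (-1) ^ i * \<omega> (merge_at G i gs)) + (-1) ^ (n + 1) * \<omega> (butlast gs))"

definition cocycles :: "('a, 'b) monoid_scheme \<Rightarrow> nat \<Rightarrow> ('a list \<Rightarrow> int) set" where
  "cocycles G n = kernel (cochains G n) (cochains G (n + 1)) (bar_d G n)"

definition coboundaries :: "('a, 'b) monoid_scheme \<Rightarrow> nat \<Rightarrow> ('a list \<Rightarrow> int) set" where
  "coboundaries G n =
     (case n of 0 \<Rightarrow> {\<one>\<^bsub>cochains G 0\<^esub>} | Suc m \<Rightarrow> bar_d G m ` carrier (cochains G m))"

text \<open>Elements of \<open>cohomology G n\<close> are cosets of the coboundaries, so a class \<open>\<alpha>\<close> is literally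
  the set of the cocycles representing it.\<close>

definition cohomology :: "('a, 'b) monoid_scheme \<Rightarrow> nat \<Rightarrow> ('a list \<Rightarrow> int) set monoid" where
  "cohomology G n = (cochains G n)\<lparr>carrier := cocycles G n\<rparr> Mod coboundaries G n"

definition bounded_ints :: "int set \<Rightarrow> bool" where
  "bounded_ints S \<longleftrightarrow> bdd_below S \<and> bdd_above S"

definition bounded_cochain :: "('a, 'b) monoid_scheme \<Rightarrow> nat \<Rightarrow> ('a list \<Rightarrow> int) \<Rightarrow> bool" where
  "bounded_cochain G n \<omega> \<longleftrightarrow> bounded_ints (\<omega> ` tuples G n)"

text \<open>Only meaningful for \<open>n \<ge> 1\<close>; the first argument varies, all others are fixed.\<close>

definition weakly_bounded_cochain :: "('a, 'b) monoid_scheme \<Rightarrow> nat \<Rightarrow> ('a list \<Rightarrow> int) \<Rightarrow> bool" where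
  "weakly_bounded_cochain G n \<omega> \<longleftrightarrow>
     (\<forall>hs \<in> tuples G (n - 1). bounded_ints ((\<lambda>g. \<omega> (g # hs)) ` carrier G))"

definition bounded_class :: "('a, 'b) monoid_scheme \<Rightarrow> nat \<Rightarrow> ('a list \<Rightarrow> int) set \<Rightarrow> bool" where
  "bounded_class G n \<alpha> \<longleftrightarrow> (\<exists>\<omega> \<in> \<alpha>. bounded_cochain G n \<omega>)"

definition weakly_bounded_class :: "('a, 'b) monoid_scheme \<Rightarrow> nat \<Rightarrow> ('a list \<Rightarrow> int) set \<Rightarrow> bool" where
  "weakly_bounded_class G n \<alpha> \<longleftrightarrow> (\<exists>\<omega> \<in> \<alpha>. weakly_bounded_cochain G n \<omega>)"

end

theory Submission
  imports Defs
begin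

text \<open>
  Bounded functions \<open>h : \<nat> \<rightarrow> \<int>\<close> and permutations \<open>s\<close> of \<open>\<nat>\<close> form the group of the bijections
  \<open>(x, m) \<mapsto> (s x, m + h x)\<close> of \<open>\<nat> \<times> \<int>\<close>, composed from left to right. Its quotient by the
  central subgroup of the constant functions consists of the pairs with \<open>h 0 = 0\<close>, with
  extension cocycle \<open>c ((h, s), (k, t)) = k (s 0)\<close>; it is weakly bounded because \<open>k\<close> is bounded.
  A paradoxical decomposition of \<open>\<nat>\<close> gives \<open>h, k, s, t\<close> with
  \<open>h \<circ> s - h + k \<circ> t - k = 1\<close>, so that in the extension every multiple of the central
  generator is a product of two commutators. A bounded representative of the class would bound
  these multiples. All of this already happens in the subgroup generated by
  \<open>(h, id), (k, id), (0, s), (0, t)\<close>.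
\<close>

lemma bounded_ints_iff: "bounded_ints S \<longleftrightarrow> (\<exists>B. \<forall>x\<in>S. \<bar>x\<bar> \<le> B)"
proof
  assume "bounded_ints S"
  then obtain a b where "\<And>x. x \<in> S \<Longrightarrow> a \<le> x \<and> x \<le> b"
    unfolding bounded_ints_def bdd_below_def bdd_above_def by blast
  then have "\<forall>x\<in>S. \<bar>x\<bar> \<le> \<bar>a\<bar> + \<bar>b\<bar>" by fastforce
  then show "\<exists>B. \<forall>x\<in>S. \<bar>x\<bar> \<le> B" ..
next
  assume "\<exists>B. \<forall>x\<in>S. \<bar>x\<bar> \<le> B"
  then obtain B where B: "\<And>x. x \<in> S \<Longrightarrow> \<bar>x\<bar> \<le> B" by blast
  have "- B \<le> x" "x \<le> B" if "x \<in> S" for x using B[OF that] by auto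
  then show "bounded_ints S" unfolding bounded_ints_def by (meson bdd_belowI bdd_aboveI)
qed

section \<open>Degree two cocycles\<close>

lemma tuples_1: "tuples G 1 = {[x] |x. x \<in> carrier G}"
  by (auto simp: tuples_def length_Suc_conv)

lemma tuples_2: "tuples G 2 = {[x, y] |x y. x \<in> carrier G \<and> y \<in> carrier G}"
  by (auto simp: tuples_def numeral_2_eq_2 length_Suc_conv)

lemma tuples_3:
  "tuples G 3 = {[x, y, z] |x y z. x \<in> carrier G \<and> y \<in> carrier G \<and> z \<in> carrier G}"
  by (auto simp: tuples_def numeral_3_eq_3 length_Suc_conv)

lemma bar_d_1:
  assumes "x \<in> carrier G" "y \<in> carrier G"
  shows "bar_d G 1 f [x, y] = f [y] - f [x \<otimes>\<^bsub>G\<^esub> y] + f [x]"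
  using assms by (auto simp: bar_d_def tuples_def merge_at_def)

lemma bar_d_2:
  assumes "x \<in> carrier G" "y \<in> carrier G" "z \<in> carrier G"
  shows "bar_d G 2 w [x, y, z] =
    w [y, z] - w [x \<otimes>\<^bsub>G\<^esub> y, z] + w [x, y \<otimes>\<^bsub>G\<^esub> z] - w [x, y]"
proof -
  have "{1..2} = {1, 2::nat}" by auto
  then show ?thesis using assms by (simp add: bar_d_def tuples_def merge_at_def)
qed

text \<open>Reduces the problem to a function \<open>c\<close> of two variables. The class of
  \<open>c\<close> consists of the cochains c + df, so \<open>c\<close> itself shows weak
  boundedness, while \<open>unbounded\<close> has to hold for every 1-cochain
  \<open>f\<close>.\<close>

lemma exists_weakly_bounded_unbounded_class:
  assumes "group G"
    and coc: "\<And>x y z. x \<in> carrier G \<Longrightarrow> y \<in> carrier G \<Longrightarrow> z \<in> carrier G \<Longrightarrow>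
      c y z - c (x \<otimes>\<^bsub>G\<^esub> y) z + c x (y \<otimes>\<^bsub>G\<^esub> z) - c x y = (0::int)"
    and weak: "\<And>y. y \<in> carrier G \<Longrightarrow> \<exists>B. \<forall>x\<in>carrier G. \<bar>c x y\<bar> \<le> B"
    and unbounded: "\<And>f B. \<exists>x\<in>carrier G. \<exists>y\<in>carrier G.
      \<bar>c x y + f x + f y - f (x \<otimes>\<^bsub>G\<^esub> y)\<bar> > B"
  shows "\<exists>\<alpha>. \<alpha> \<in> carrier (cohomology G 2) \<and> weakly_bounded_class G 2 \<alpha> \<and> \<not> bounded_class G 2 \<alpha>"
proof -
  interpret group G by fact
  define w where "w = (\<lambda>gs\<in>tuples G 2. c (gs ! 0) (gs ! 1))"
  have w: "w [x, y] = c x y" if "x \<in> carrier G" "y \<in> carrier G" for x y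
    using that by (simp add: w_def tuples_def)
  have w_cochain: "w \<in> carrier (cochains G 2)"
    by (simp add: w_def cochains_def)
  have dw: "bar_d G 2 w = \<one>\<^bsub>cochains G 3\<^esub>"
  proof
    fix gs
    show "bar_d G 2 w gs = \<one>\<^bsub>cochains G 3\<^esub> gs"
    proof (cases "gs \<in> tuples G 3")
      case True
      then obtain x y z where xyz: "gs = [x, y, z]" "x \<in> carrier G" "y \<in> carrier G" "z \<in> carrier G"
        by (auto simp: tuples_3)
      then show ?thesis using True coc[of x y z] by (simp add: bar_d_2 w cochains_def)
    next
      case False
      then show ?thesis by (simp add: bar_d_def cochains_def)
    qed
  qed
  have w_cocycle: "w \<in> cocycles G 2"
    using w_cochain dw by (simp add: cocycles_def kernel_def)
  define C where "C = (cochains G 2)\<lparr>carrier := cocycles G 2\<rparr>"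
  define \<alpha> where "\<alpha> = coboundaries G 2 #>\<^bsub>C\<^esub> w"
  have coboundaries: "coboundaries G 2 = bar_d G 1 ` carrier (cochains G 1)"
    by (simp add: coboundaries_def numeral_2_eq_2)
  \<comment> \<open>The restriction to pairs comes from the pointwise product in
    \<open>cochains G 2\<close>.\<close>
  have \<alpha>: "\<alpha> = (\<lambda>f. \<lambda>gs\<in>tuples G 2. bar_d G 1 f gs + w gs) ` carrier (cochains G 1)"
    unfolding \<alpha>_def coboundaries r_coset_def C_def by (auto simp: cochains_def)
  have "\<alpha> \<in> carrier (cohomology G 2)"
    unfolding cohomology_def carrier_FactGroup \<alpha>_def C_def using w_cocycle by simp
  moreover have "weakly_bounded_class G 2 \<alpha>"
  proof -
    \<comment> \<open>This is \<open>w\<close> plus the coboundary of 0, written so that it visibly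
      lies in the coset.\<close>
    define w' where "w' = (\<lambda>gs\<in>tuples G 2. bar_d G 1 (\<lambda>gs\<in>tuples G 1. 0) gs + w gs)"
    have "w' \<in> \<alpha>" unfolding \<alpha> w'_def by (auto simp: cochains_def)
    moreover have w': "w' [x, y] = c x y" if "x \<in> carrier G" "y \<in> carrier G" for x y
      using that by (simp only: w'_def) (simp add: bar_d_1[unfolded One_nat_def] w, simp add: tuples_def)
    have "weakly_bounded_cochain G 2 w'"
      using weak by (auto simp: weakly_bounded_cochain_def tuples_1[unfolded One_nat_def] bounded_ints_iff w')
    ultimately show ?thesis unfolding weakly_bounded_class_def by blast
  qed
  moreover have "\<not> bounded_class G 2 \<alpha>"
  proof
    assume "bounded_class G 2 \<alpha>"
    then obtain f where f: "bounded_cochain G 2 (\<lambda>gs\<in>tuples G 2. bar_d G 1 f gs + w gs)"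
      unfolding bounded_class_def \<alpha> by blast
    then obtain B where B: "\<And>gs. gs \<in> tuples G 2 \<Longrightarrow> \<bar>bar_d G 1 f gs + w gs\<bar> \<le> B"
      unfolding bounded_cochain_def bounded_ints_iff by auto
    obtain x y where xy: "x \<in> carrier G" "y \<in> carrier G"
      and gt: "\<bar>c x y + f [x] + f [y] - f [x \<otimes>\<^bsub>G\<^esub> y]\<bar> > B"
      using unbounded[of B "\<lambda>x. f [x]"] by blast
    have "\<bar>bar_d G 1 f [x, y] + w [x, y]\<bar> \<le> B"
      using xy by (intro B) (auto simp: tuples_2)
    then have "\<bar>f [y] - f [x \<otimes>\<^bsub>G\<^esub> y] + f [x] + c x y\<bar> \<le> B"
      using xy by (simp only: bar_d_1 w)
    then show False using gt by (simp add: algebra_simps)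
  qed
  ultimately show ?thesis by blast
qed

section \<open>Finitely generated groups on the natural numbers\<close>

lemma countable_generate:
  assumes "countable S"
  shows "countable (generate G S)"
proof -
  \<comment> \<open>The generated subgroup is exhausted by countable stages, each adding all
    products of two earlier elements. Inverses enter only at stage 0, since \<open>generate\<close>
    introduces inverses of generators only.\<close>
  define step where "step = (\<lambda>Y. Y \<union> (\<lambda>(x, y). x \<otimes>\<^bsub>G\<^esub> y) ` (Y \<times> Y))"
  define T where "T = (\<lambda>n. (step ^^ n) (S \<union> (\<lambda>x. inv\<^bsub>G\<^esub> x) ` S \<union> {\<one>\<^bsub>G\<^esub>}))"
  have T_Suc: "T (Suc n) = step (T n)" for n by (simp add: T_def)
  have mono: "T m \<subseteq> T n" if "m \<le> n" for m n
    using that by (rule lift_Suc_mono_le[rotated]) (auto simp: T_Suc step_def)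
  have "countable (T n)" for n
    by (induction n) (use assms in \<open>auto simp: T_Suc step_def, simp add: T_def\<close>)
  moreover have "x \<in> (\<Union>n. T n)" if "x \<in> generate G S" for x
    using that
  proof induction
    case (eng x y)
    then obtain m n where "x \<in> T m" "y \<in> T n" by blast
    then have "x \<in> T (max m n)" "y \<in> T (max m n)"
      using mono[of m "max m n"] mono[of n "max m n"] by auto
    then have "x \<otimes>\<^bsub>G\<^esub> y \<in> T (Suc (max m n))"
      unfolding T_Suc step_def by (auto intro!: image_eqI[of _ _ "(x, y)"])
    then show ?case by blast
  qed (auto simp: T_def intro!: exI[of _ 0])
  ultimately show ?thesis by (meson countable_UN countable_subset subsetI countableI_type)
qed

text \<open>A finitely generated group is countable, so its structure and the cocycle can be carried
  over to a set of natural numbers along an injection.\<close>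

lemma exists_nat_group_class:
  assumes fg: "finitely_generated_group G"
    and coc: "\<And>x y z. x \<in> carrier G \<Longrightarrow> y \<in> carrier G \<Longrightarrow> z \<in> carrier G \<Longrightarrow>
      c y z - c (x \<otimes>\<^bsub>G\<^esub> y) z + c x (y \<otimes>\<^bsub>G\<^esub> z) - c x y = (0::int)"
    and weak: "\<And>y. y \<in> carrier G \<Longrightarrow> \<exists>B. \<forall>x\<in>carrier G. \<bar>c x y\<bar> \<le> B"
    and unbounded: "\<And>f B. \<exists>x\<in>carrier G. \<exists>y\<in>carrier G.
      \<bar>c x y + f x + f y - f (x \<otimes>\<^bsub>G\<^esub> y)\<bar> > B"
  shows "\<exists>(N :: nat monoid) \<alpha>. finitely_generated_group N \<and> \<alpha> \<in> carrier (cohomology N 2) \<and>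
    weakly_bounded_class N 2 \<alpha> \<and> \<not> bounded_class N 2 \<alpha>"
proof -
  obtain S where S: "finite S" "S \<subseteq> carrier G" "generate G S = carrier G"
    using fg unfolding finitely_generated_group_def by blast
  interpret group G using fg unfolding finitely_generated_group_def by blast
  have "countable (carrier G)"
    using countable_generate[of S G] S by (simp add: countable_finite)
  then obtain e :: "'a \<Rightarrow> nat" where e: "inj_on e (carrier G)"
    unfolding countable_def by blast
  define N where "N = image_group e G"
  define g where "g = inv_into (carrier G) e"
  have N_carrier: "carrier N = e ` carrier G"
    by (simp add: N_def image_group_carrier)
  have ge: "g (e x) = x" if "x \<in> carrier G" for x
    using that e by (simp add: g_def)
  have N_mult: "e x \<otimes>\<^bsub>N\<^esub> e y = e (x \<otimes>\<^bsub>G\<^esub> y)" if "x \<in> carrier G" "y \<in> carrier G" for x y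
    using that ge by (simp add: N_def image_group_def flip: g_def)
  \<comment> \<open>For the trivial normal subgroup, a weak morphism is just an injective map; this
    is what makes the image a group.\<close>
  have morph: "weak_group_morphism e {\<one>\<^bsub>G\<^esub>} G"
  proof (rule weak_group_morphismsI)
    show "{\<one>\<^bsub>G\<^esub>} \<lhd> G" by (rule one_is_normal)
    show "e a = e b \<longleftrightarrow> a \<otimes>\<^bsub>G\<^esub> inv\<^bsub>G\<^esub> b \<in> {\<one>\<^bsub>G\<^esub>}"
      if "a \<in> carrier G" "b \<in> carrier G" for a b
    proof -
      have "a \<otimes>\<^bsub>G\<^esub> inv\<^bsub>G\<^esub> b = \<one>\<^bsub>G\<^esub> \<longleftrightarrow> a = b"
        using that inv_solve_right'[of "\<one>\<^bsub>G\<^esub>" a b] by auto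
      then show ?thesis using that e by (simp add: inj_on_eq_iff)
    qed
  qed
  have N: "group N" unfolding N_def by (rule image_group_is_group[OF morph])
  have "e \<in> hom G N" by (auto simp: hom_def N_carrier N_mult)
  then have "group_hom G N e"
    using N group_axioms by (simp add: group_hom_def group_hom_axioms_def)
  then have gen: "generate N (e ` S) = carrier N"
    using group_hom.generate_img[of G N e S] S(2,3) N_carrier by metis
  have "finite (e ` S)" "e ` S \<subseteq> carrier N" using S(1,2) by (auto simp: N_carrier)
  then have "finitely_generated_group N"
    unfolding finitely_generated_group_def using N gen by blast
  moreover have "\<exists>\<alpha>. \<alpha> \<in> carrier (cohomology N 2) \<and> weakly_bounded_class N 2 \<alpha> \<and>
      \<not> bounded_class N 2 \<alpha>"
  proof (rule exists_weakly_bounded_unbounded_class[of N "\<lambda>x y. c (g x) (g y)"])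
    show "\<exists>x\<in>carrier N. \<exists>y\<in>carrier N.
        \<bar>c (g x) (g y) + f x + f y - f (x \<otimes>\<^bsub>N\<^esub> y)\<bar> > B" for f B
    proof -
      obtain x y where xy: "x \<in> carrier G" "y \<in> carrier G"
        and gt: "\<bar>c x y + f (e x) + f (e y) - f (e (x \<otimes>\<^bsub>G\<^esub> y))\<bar> > B"
        using unbounded[of B "\<lambda>x. f (e x)"] by blast
      show ?thesis
      proof (rule bexI[of _ "e x"], rule bexI[of _ "e y"])
        show "\<bar>c (g (e x)) (g (e y)) + f (e x) + f (e y) - f (e x \<otimes>\<^bsub>N\<^esub> e y)\<bar> > B"
          using gt by (simp only: ge[OF xy(1)] ge[OF xy(2)] N_mult[OF xy])
      qed (use xy in \<open>simp_all add: N_carrier\<close>)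
    qed
    show "c (g y) (g z) - c (g (x \<otimes>\<^bsub>N\<^esub> y)) (g z) + c (g x) (g (y \<otimes>\<^bsub>N\<^esub> z)) - c (g x) (g y) = 0"
      if xyz: "x \<in> carrier N" "y \<in> carrier N" "z \<in> carrier N" for x y z
    proof -
      obtain x' y' z' where eq: "x = e x'" "y = e y'" "z = e z'"
        and G: "x' \<in> carrier G" "y' \<in> carrier G" "z' \<in> carrier G"
        using xyz unfolding N_carrier by blast
      show ?thesis
        using coc[OF G] unfolding eq by (simp only: N_mult ge m_closed G)
    qed
    show "\<exists>B. \<forall>x\<in>carrier N. \<bar>c (g x) (g y)\<bar> \<le> B" if "y \<in> carrier N" for y
      using that weak[of "g y"] by (auto simp: N_carrier ge)
  qed (rule N)
  ultimately have "\<exists>\<alpha>. finitely_generated_group N \<and> \<alpha> \<in> carrier (cohomology N 2) \<and>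
      weakly_bounded_class N 2 \<alpha> \<and> \<not> bounded_class N 2 \<alpha>"
    by simp
  then show ?thesis by (rule exI)
qed

section \<open>Permutations\<close>

text \<open>Any two infinite subsets of the naturals are in bijection, so a bijection from
  \<open>A\<close> to \<open>B\<close> can be glued to one between the complements.\<close>

lemma exists_permutation_vimage:
  fixes A B :: "nat set"
  assumes "infinite A" "infinite (- A)" "infinite B" "infinite (- B)"
  shows "\<exists>s. bij s \<and> (\<forall>x. s x \<in> B \<longleftrightarrow> x \<in> A)"
proof -
  have "\<exists>f. bij_betw f A' B'" if "infinite A'" "infinite B'" for A' B' :: "nat set"
  proof -
    have "bij_betw (enumerate B' \<circ> inv_into UNIV (enumerate A')) A' B'"
      using that by (intro bij_betw_trans[OF bij_betw_inv_into] bij_enumerate)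
    then show ?thesis by blast
  qed
  then obtain f g where f: "bij_betw f A B" and g: "bij_betw g (- A) (- B)"
    using assms by metis
  define s where "s = (\<lambda>x. if x \<in> A then f x else g x)"
  have "bij_betw s A B" using f by (subst bij_betw_cong[of A s f]) (auto simp: s_def)
  moreover have "bij_betw s (- A) (- B)" using g by (subst bij_betw_cong[of "- A" s g]) (auto simp: s_def)
  ultimately have "bij s" and "s ` A = B" "s ` (- A) = - B"
    using bij_betw_combine[of s A B "- A" "- B"] by (auto simp: bij_betw_def)
  then show ?thesis by (intro exI[of _ s]) auto
qed

lemma infinite_residue_class:
  assumes "r < (m::nat)"
  shows "infinite {x. x mod m = r}"
  unfolding infinite_nat_iff_unbounded
proof
  fix n
  have "n < m * (n + 1) + r" using assms by (cases m) auto
  moreover have "(m * (n + 1) + r) mod m = r" using assms mod_mult_self4[of m "n + 1" r] by simp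
  ultimately show "\<exists>x>n. x \<in> {x. x mod m = r}" by blast
qed

lemma exists_paradoxical_decomposition:
  obtains A B :: "nat set" and s t :: "nat \<Rightarrow> nat"
  where "bij s" "bij t" "0 \<notin> A" "0 \<notin> B"
    "\<And>x. of_bool (s x \<in> A) - of_bool (x \<in> A) + of_bool (t x \<in> B) - of_bool (x \<in> B) = (1::int)"
proof -
  \<comment> \<open>Modulo 4, the indicators of the complements of 0 and of 1 add up to
    1 plus the indicators of 2 and of 3.\<close>
  define R where "R = (\<lambda>r. {x. x mod 4 = (r::nat)})"
  have inf: "infinite C" if "R r \<subseteq> C" "r < 4" for r C
    using infinite_residue_class[of r 4] that finite_subset unfolding R_def by blast
  have "\<exists>s. bij s \<and> (\<forall>x. s x \<in> R 3 \<longleftrightarrow> x \<in> - R 0)"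
    by (intro exists_permutation_vimage inf[of 0 "- (- R 0)"] inf[of 1 "- R 0"]
          inf[of 3 "R 3"] inf[of 0 "- R 3"]) (auto simp: R_def)
  then obtain s where s: "bij s" "\<And>x. s x \<in> R 3 \<longleftrightarrow> x \<in> - R 0" by blast
  have "\<exists>t. bij t \<and> (\<forall>x. t x \<in> R 2 \<longleftrightarrow> x \<in> - R 1)"
    by (intro exists_permutation_vimage inf[of 1 "- (- R 1)"] inf[of 0 "- R 1"]
          inf[of 2 "R 2"] inf[of 0 "- R 2"]) (auto simp: R_def)
  then obtain t where t: "bij t" "\<And>x. t x \<in> R 2 \<longleftrightarrow> x \<in> - R 1" by blast
  show thesis
  \<comment> \<open>Neither residue class contains 0, so both indicators vanish at 0, as
    \<open>skew_group\<close> demands of its function components.\<close>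
  proof (rule that[of s t "R 3" "R 2"])
    fix x :: nat
    show "of_bool (s x \<in> R 3) - of_bool (x \<in> R 3) + of_bool (t x \<in> R 2) - of_bool (x \<in> R 2) = (1::int)"
      unfolding s t by (auto simp: R_def of_bool_def)
  qed (use s t in \<open>auto simp: R_def\<close>)
qed

section \<open>The group of bounded functions and permutations\<close>

text \<open>The condition \<open>h 0 = 0\<close> selects one representative modulo constants.
  Composing first \<open>(h, s)\<close> and then \<open>(k, t)\<close> gives the function
  \<open>h x + k (s x)\<close>, with value \<open>k (s 0)\<close> at 0; subtracting this value
  normalises the product.\<close>

definition skew_group :: "((nat \<Rightarrow> int) \<times> (nat \<Rightarrow> nat)) monoid" where
  "skew_group = \<lparr>
     carrier = {(h, s). bounded_ints (range h) \<and> h 0 = 0 \<and> bij s},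
     monoid.mult = (\<lambda>(h, s) (k, t). (\<lambda>x. h x + k (s x) - k (s 0), t \<circ> s)),
     one = (\<lambda>_. 0, id)\<rparr>"

text \<open>The constant discarded when the product is normalised. The first argument enters only
  through the point to which its permutation sends 0.\<close>

definition skew_cocycle :: "(nat \<Rightarrow> int) \<times> (nat \<Rightarrow> nat) \<Rightarrow> (nat \<Rightarrow> int) \<times> (nat \<Rightarrow> nat) \<Rightarrow> int" where
  "skew_cocycle p q = fst q (snd p 0)"

text \<open>Shaped like the function component of a product; with 0 and a negated function it also
  covers inverses.\<close>

lemma bounded_range_translate:
  assumes "bounded_ints (range (h :: nat \<Rightarrow> int))" "bounded_ints (range (k :: nat \<Rightarrow> int))"
  shows "bounded_ints (range (\<lambda>x. h x + k (s x) - b))"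
proof -
  obtain B C where B: "\<And>x. \<bar>h x\<bar> \<le> B" and C: "\<And>x. \<bar>k x\<bar> \<le> C"
    using assms by (auto simp: bounded_ints_iff)
  have "\<bar>h x + k (s x) - b\<bar> \<le> B + C + \<bar>b\<bar>" for x
    using B[of x] C[of "s x"] by linarith
  then show ?thesis by (auto simp: bounded_ints_iff)
qed

lemma bounded_range_uminus:
  assumes "bounded_ints (range (h :: nat \<Rightarrow> int))"
  shows "bounded_ints (range (\<lambda>x. - h x))"
  using assms by (simp add: bounded_ints_iff)

lemma bounded_range_const: "bounded_ints (range (\<lambda>_::nat. b))"
  by (auto simp: bounded_ints_iff)

lemma group_skew_group: "group skew_group"
proof (rule groupI)
  fix p assume "p \<in> carrier skew_group"
  then obtain h s where p: "p = (h, s)" "bounded_ints (range h)" "h 0 = 0" "bij s"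
    by (auto simp: skew_group_def)
  define s' where "s' = inv_into UNIV s"
  have s': "bij s'" "s' (s x) = x" "s (s' x) = x" for x
    using p by (auto simp: s'_def bij_imp_bij_inv bij_is_inj bij_is_surj surj_f_inv_f)
  \<comment> \<open>The inverse has function component \<open>- h \<circ> s'\<close>, shifted by a
    constant to vanish at 0.\<close>
  have "bounded_ints (range (\<lambda>x. 0 + - h (s' x) - - h (s' 0)))"
    by (intro bounded_range_translate bounded_range_const bounded_range_uminus p)
  then show "\<exists>q\<in>carrier skew_group. q \<otimes>\<^bsub>skew_group\<^esub> p = \<one>\<^bsub>skew_group\<^esub>"
    using p s'
    by (intro bexI[of _ "(\<lambda>x. - h (s' x) + h (s' 0), s')"]) (auto simp: skew_group_def fun_eq_iff)
qed (auto simp: skew_group_def bounded_range_translate bounded_range_const[simplified] bij_comp algebra_simps)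


lemma skew_group_mult:
  "(h, s) \<otimes>\<^bsub>skew_group\<^esub> (k, t) = (\<lambda>x. h x + k (s x) - k (s 0), t \<circ> s)"
  by (simp add: skew_group_def)

lemma skew_group_one: "\<one>\<^bsub>skew_group\<^esub> = (\<lambda>_. 0, id)"
  by (simp add: skew_group_def)

lemma skew_group_carrier:
  "(h, s) \<in> carrier skew_group \<longleftrightarrow> bounded_ints (range h) \<and> h 0 = 0 \<and> bij s"
  by (simp add: skew_group_def)

text \<open>For \<open>q = (k, t)\<close> and \<open>r = (l, u)\<close> the third term is
  \<open>k (s 0) + l (t (s 0)) - l (t 0)\<close>, where \<open>s\<close> is the permutation of
  \<open>p\<close>, and everything cancels.\<close>

lemma skew_cocycle_identity:
  "skew_cocycle q r - skew_cocycle (p \<otimes>\<^bsub>skew_group\<^esub> q) r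
    + skew_cocycle p (q \<otimes>\<^bsub>skew_group\<^esub> r) - skew_cocycle p q = 0"
  by (cases p; cases q; cases r) (simp add: skew_cocycle_def skew_group_mult)

lemma skew_cocycle_weakly_bounded:
  assumes "q \<in> carrier skew_group"
  shows "\<exists>B. \<forall>p. \<bar>skew_cocycle p q\<bar> \<le> B"
  using assms by (cases q) (auto simp: skew_group_carrier skew_cocycle_def bounded_ints_iff)

section \<open>Conjugation and unboundedness in subgroups\<close>

lemma subgroup_skew_group_multiple:
  assumes "subgroup H skew_group" "(h, id) \<in> H"
  shows "(\<lambda>x. int n * h x, id) \<in> H"
proof (induction n)
  case 0
  then show ?case using subgroup.one_closed[OF assms(1)] by (simp add: skew_group_one id_def)
next
  case (Suc n)
  have "h 0 = 0" using subgroup.mem_carrier[OF assms] by (simp add: skew_group_carrier)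
  then show ?case using subgroup.m_closed[OF assms(1) Suc assms(2)]
    by (simp add: skew_group_mult algebra_simps)
qed

text \<open>Conjugating \<open>(h, id)\<close> by \<open>(0, s)\<close> precomposes \<open>h\<close>
  with \<open>s\<close> and normalises the result at 0.\<close>

lemma subgroup_skew_group_conj:
  assumes H: "subgroup H skew_group" and h: "(h, id) \<in> H" and s: "(\<lambda>_. 0, s) \<in> H"
  shows "(\<lambda>x. h (s x) - h (s 0), id) \<in> H"
proof -
  interpret group skew_group by (rule group_skew_group)
  obtain k r where inv: "inv\<^bsub>skew_group\<^esub> (\<lambda>_. 0, s) = (k, r)" by fastforce
  have "(\<lambda>_. 0, s) \<otimes>\<^bsub>skew_group\<^esub> (k, r) = \<one>\<^bsub>skew_group\<^esub>"
    using r_inv[OF subgroup.mem_carrier[OF H s]] inv by simp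
  \<comment> \<open>The function \<open>k \<circ> s\<close> is constant. The arbitrary summand
    \<open>m\<close> turns this into a rewrite rule that removes \<open>k\<close> from the triple
    product below.\<close>
  then have kr: "m + k (s x) - k (s 0) = m" "r \<circ> s = id" for m x
    by (auto simp: skew_group_mult skew_group_one fun_eq_iff)
  have "(\<lambda>_. 0, s) \<otimes>\<^bsub>skew_group\<^esub> (h, id) \<otimes>\<^bsub>skew_group\<^esub> (k, r) \<in> H"
    using subgroup.m_inv_closed[OF H s] inv by (intro subgroup.m_closed[OF H] h s) simp
  moreover have "(\<lambda>_. 0, s) \<otimes>\<^bsub>skew_group\<^esub> (h, id) \<otimes>\<^bsub>skew_group\<^esub> (k, r) =
      (\<lambda>x. h (s x) - h (s 0), id)"
    by (simp only: skew_group_mult id_o add_0 kr)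
  ultimately show ?thesis by simp
qed

text \<open>A bound on c + df makes \<open>f\<close> almost additive wherever \<open>c\<close>
  vanishes, while conjugation shifts \<open>f\<close> by almost \<open>m (r 0)\<close>. Scaling the
  paradoxical identity by \<open>n\<close> makes these shifts add up to \<open>n\<close>. An
  arbitrary subgroup containing the four elements is allowed, so that a finitely generated one can
  be used.\<close>

lemma skew_cocycle_unbounded:
  assumes H: "subgroup H skew_group"
    and hk: "(h, id) \<in> H" "(k, id) \<in> H" and st: "(\<lambda>_. 0, s) \<in> H" "(\<lambda>_. 0, t) \<in> H"
    and paradox: "\<And>x. h (s x) - h x + k (t x) - k x = 1"
  shows "\<exists>p\<in>H. \<exists>q\<in>H. \<bar>skew_cocycle p q + f p + f q - f (p \<otimes>\<^bsub>skew_group\<^esub> q)\<bar> > B"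
proof (rule ccontr)
  assume "\<not> ?thesis"
  then have B: "\<bar>skew_cocycle p q + f p + f q - f (p \<otimes>\<^bsub>skew_group\<^esub> q)\<bar> \<le> B"
    if "p \<in> H" "q \<in> H" for p q
    using that by (meson linorder_not_le)
  \<comment> \<open>The conjugate of \<open>(m, id)\<close> times \<open>(0, r)\<close> equals
    \<open>(0, r)\<close> times \<open>(m, id)\<close>, but the cocycle is 0 on the first pair and
    \<open>m (r 0)\<close> on the second. Comparing the two costs \<open>2 * B\<close>.\<close>
  have conj: "\<bar>f (\<lambda>x. m (r x) - m (r 0), id) - f (m, id) - m (r 0)\<bar> \<le> 2 * B"
    if m: "(m, id) \<in> H" and r: "(\<lambda>_. 0, r) \<in> H" for m r
  proof -
    have "\<bar>f (\<lambda>x. m (r x) - m (r 0), id) + f (\<lambda>_. 0, r) - f (\<lambda>x. m (r x) - m (r 0), r)\<bar> \<le> B"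
      using B[OF subgroup_skew_group_conj[OF H m r] r] by (simp add: skew_group_mult skew_cocycle_def)
    moreover have "\<bar>m (r 0) + f (\<lambda>_. 0, r) + f (m, id) - f (\<lambda>x. m (r x) - m (r 0), r)\<bar> \<le> B"
      using B[OF r m] by (simp add: skew_group_mult skew_cocycle_def)
    ultimately show ?thesis by linarith
  qed
  \<comment> \<open>Two conjugations cost \<open>2 * B\<close> each and two products cost
    \<open>B\<close> each, so \<open>n\<close> is chosen just above \<open>6 * B\<close>.\<close>
  define n where "n = nat (6 * B + 1)"
  define h1 where "h1 = (\<lambda>x. int n * h x)"
  define k1 where "k1 = (\<lambda>x. int n * k x)"
  define h2 where "h2 = (\<lambda>x. h1 (s x) - h1 (s 0))"
  define k2 where "k2 = (\<lambda>x. k1 (t x) - k1 (t 0))"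
  have zero: "h 0 = 0" "k 0 = 0"
    using hk subgroup.mem_carrier[OF H] by (auto simp: skew_group_carrier)
  have mem1: "(h1, id) \<in> H" "(k1, id) \<in> H"
    unfolding h1_def k1_def using hk by (auto intro: subgroup_skew_group_multiple[OF H])
  have mem2: "(h2, id) \<in> H" "(k2, id) \<in> H"
    unfolding h2_def k2_def using mem1 st by (auto intro: subgroup_skew_group_conj[OF H])
  have k2_0: "k2 0 = 0" by (simp add: k2_def)
  \<comment> \<open>Subtracting the paradoxical identity at 0 from the one at \<open>x\<close>
    removes the constant 1: modulo constants the two conjugations cancel, and only the cocycle still
    sees them.\<close>
  have mult: "(h2, id) \<otimes>\<^bsub>skew_group\<^esub> (k2, id) = (h1, id) \<otimes>\<^bsub>skew_group\<^esub> (k1, id)"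
  proof -
    have "h2 x + k2 x = h1 x + k1 x" for x
    proof -
      have "h (s x) - h (s 0) + (k (t x) - k (t 0)) = h x + k x"
        using paradox[of x] paradox[of 0] zero by linarith
      then show ?thesis unfolding h2_def k2_def h1_def k1_def
        by (metis (no_types, lifting) distrib_left right_diff_distrib)
    qed
    then show ?thesis using zero by (simp add: skew_group_mult k1_def k2_def)
  qed
  have "\<bar>f (h1, id) + f (k1, id) - f ((h1, id) \<otimes>\<^bsub>skew_group\<^esub> (k1, id))\<bar> \<le> B"
    using B[OF mem1] zero by (simp add: skew_cocycle_def k1_def)
  moreover have "\<bar>f (h2, id) + f (k2, id) - f ((h1, id) \<otimes>\<^bsub>skew_group\<^esub> (k1, id))\<bar> \<le> B"
    using B[OF mem2] k2_0 by (simp add: skew_cocycle_def mult)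
  moreover have "\<bar>f (h2, id) - f (h1, id) - h1 (s 0)\<bar> \<le> 2 * B"
    unfolding h2_def by (intro conj mem1 st)
  moreover have "\<bar>f (k2, id) - f (k1, id) - k1 (t 0)\<bar> \<le> 2 * B"
    unfolding k2_def by (intro conj mem1 st)
  ultimately have "h1 (s 0) + k1 (t 0) \<le> 6 * B" by linarith
  \<comment> \<open>Since \<open>h\<close> and \<open>k\<close> vanish at 0, the paradoxical
    identity at 0 reads \<open>h (s 0) + k (t 0) = 1\<close>.\<close>
  moreover have "h1 (s 0) + k1 (t 0) = int n"
    using paradox[of 0] zero unfolding h1_def k1_def by (simp flip: distrib_left)
  ultimately show False by (simp add: n_def split: if_splits)
qed

theorem corollary10:
  shows "\<exists>(G :: nat monoid) \<alpha>.
           finitely_generated_group G \<and>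
           \<alpha> \<in> carrier (cohomology G 2) \<and>
           weakly_bounded_class G 2 \<alpha> \<and> \<not> bounded_class G 2 \<alpha>"
proof -
  obtain A B :: "nat set" and s t :: "nat \<Rightarrow> nat"
    where st: "bij s" "bij t" and AB: "0 \<notin> A" "0 \<notin> B"
      and paradox: "\<And>x. of_bool (s x \<in> A) - of_bool (x \<in> A)
        + of_bool (t x \<in> B) - of_bool (x \<in> B) = (1::int)"
    by (rule exists_paradoxical_decomposition) blast
  define h :: "nat \<Rightarrow> int" where "h = (\<lambda>x. of_bool (x \<in> A))"
  define k :: "nat \<Rightarrow> int" where "k = (\<lambda>x. of_bool (x \<in> B))"
  \<comment> \<open>The whole of \<open>skew_group\<close> is uncountable, hence not finitely
    generated; these four elements are all that the unboundedness argument uses.\<close>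
  define S where "S = {(h, id), (k, id), (\<lambda>_. 0, s), (\<lambda>_. 0, t)}"
  define H where "H = generate skew_group S"
  interpret group skew_group by (rule group_skew_group)
  have "bounded_ints (range h)" "bounded_ints (range k)"
    by (auto simp: bounded_ints_iff h_def k_def intro!: exI[of _ 1])
  then have S: "S \<subseteq> carrier skew_group"
    using st AB bounded_range_const[of 0]
    by (auto simp: S_def skew_group_carrier h_def k_def simp del: image_constant)
  have H: "subgroup H skew_group"
    unfolding H_def by (rule generate_is_subgroup[OF S])
  have SH: "S \<subseteq> H" unfolding H_def by (auto intro: generate.incl)
  define G where "G = skew_group\<lparr>carrier := H\<rparr>"
  show ?thesis
  proof (rule exists_nat_group_class[of G skew_cocycle])
    have "generate G S = carrier G"
      unfolding G_def using generate_consistent[OF SH H] by (simp add: H_def)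
    moreover have "group G" unfolding G_def by (rule subgroup_imp_group[OF H])
    moreover have "finite S" "S \<subseteq> carrier G" using SH by (simp_all add: G_def S_def)
    ultimately show "finitely_generated_group G"
      unfolding finitely_generated_group_def by blast
    show "\<exists>B. \<forall>x\<in>carrier G. \<bar>skew_cocycle x y\<bar> \<le> B" if "y \<in> carrier G" for y
    proof -
      have "y \<in> carrier skew_group" using that subgroup.mem_carrier[OF H] by (simp add: G_def)
      then show ?thesis using skew_cocycle_weakly_bounded by meson
    qed
    show "\<exists>x\<in>carrier G. \<exists>y\<in>carrier G.
        \<bar>skew_cocycle x y + f x + f y - f (x \<otimes>\<^bsub>G\<^esub> y)\<bar> > B" for f B
    proof -
      have "h (s x) - h x + k (t x) - k x = 1" for x
        using paradox by (simp add: h_def k_def)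
      then show ?thesis
        using skew_cocycle_unbounded[OF H, of h k s t B f] SH by (simp add: G_def S_def)
    qed
  qed (simp add: G_def skew_cocycle_identity)
qed

end
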